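(* Let $(p\colon\mathbb{E}\to\mathbb{B},O,\Omega)$ and $(q\colon\mathbb{F}\to\mathbb{C},O',\Pi)$ be $\mathbf{CLat}_\sqcap$-fibrations with truth values indexed by the same discrete category $A$, let $F\colon\mathbb{B}\to\mathbb{C}$ and $\tau\colon F\circ O\Rightarrow O'$. For any lifting $\dot F\colon\mathbb{E}\to\mathbb{F}$ of $F$ along $p,q$ (i.e. $q\circ\dot F=F\circ p$), we have $\dot F(P)\sqsubseteq F^{\Omega,\Pi}_{\tau}(P)$ for all $P\in\mathbb{E}$ if and only if for every $a\in A$, $\tau_a$ underlies an $\mathbb{F}$-morphism $\dot F(\Omega(a))\to\Pi(a)$, i.e. $\dot F(\Omega(a))\sqsubseteq\tau_a^*\Pi(a)$ (equivalently, $\tau$ lifts to a natural transformation $\dot F\circ\Omega\Rightarrow\Pi$).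
   Context: A $\mathbf{CLat}_\sqcap$-fibration is a posetal fibration whose fibers are complete lattices (order $\sqsubseteq$, meet $\bigwedge$) with meet-preserving reindexing $f^*$; a $\mathbf{CLat}_\sqcap$-fibration with truth values is $(p,O\colon A\to\mathbb{B},\Omega\colon A\to\mathbb{E})$ with $A$ discrete and $O=p\circ\Omega$. The generalized codensity lifting is $F^{\Omega,\Pi}_{\tau}(P)=\bigwedge_{a\in A,\,k\in\mathbb{E}(P,\Omega(a))}(\tau_a\circ F(pk))^*(\Pi(a))$. *)

theory Defs
  imports "HOL-Algebra.Complete_Lattice"
begin

text \<open>
  Composition is in applicative order, so \<open>g \<cdot>\<^bsub>\<C>\<^esub> f\<close> is \<open>g\<close> after \<open>f\<close>;
  it is unconstrained on non-composable pairs.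
\<close>

record ('o, 'm) category =
  Obj :: "'o set"
  Arr :: "'m set"
  Dom :: "'m \<Rightarrow> 'o"
  Cod :: "'m \<Rightarrow> 'o"
  Id :: "'o \<Rightarrow> 'm"
  Comp :: "'m \<Rightarrow> 'm \<Rightarrow> 'm"  (infixl \<open>\<cdot>\<index>\<close> 70)

definition Hom :: "('o, 'm) category \<Rightarrow> 'o \<Rightarrow> 'o \<Rightarrow> 'm set" where
  "Hom \<C> X Y = {f \<in> Arr \<C>. Dom \<C> f = X \<and> Cod \<C> f = Y}"

locale category =
  fixes \<C> :: "('o, 'm) category" (structure)
  assumes Dom_closed: "f \<in> Arr \<C> \<Longrightarrow> Dom \<C> f \<in> Obj \<C>"
    and Cod_closed: "f \<in> Arr \<C> \<Longrightarrow> Cod \<C> f \<in> Obj \<C>"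
    and Id_closed: "X \<in> Obj \<C> \<Longrightarrow> Id \<C> X \<in> Hom \<C> X X"
    and Comp_closed: "f \<in> Hom \<C> X Y \<Longrightarrow> g \<in> Hom \<C> Y Z \<Longrightarrow> g \<cdot> f \<in> Hom \<C> X Z"
    and Comp_assoc: "f \<in> Hom \<C> W X \<Longrightarrow> g \<in> Hom \<C> X Y \<Longrightarrow> h \<in> Hom \<C> Y Z \<Longrightarrow>
      (h \<cdot> g) \<cdot> f = h \<cdot> (g \<cdot> f)"
    and Comp_Id_right: "f \<in> Hom \<C> X Y \<Longrightarrow> f \<cdot> Id \<C> X = f"
    and Comp_Id_left: "f \<in> Hom \<C> X Y \<Longrightarrow> Id \<C> Y \<cdot> f = f"

locale discrete_category = category +
  assumes arrows_are_identities: "f \<in> Arr \<C> \<Longrightarrow> f = Id \<C> (Dom \<C> f)"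

record ('o, 'm, 'p, 'n) functor_data =
  OMap :: "'o \<Rightarrow> 'p"
  AMap :: "'m \<Rightarrow> 'n"

locale cat_functor = source: category \<C> + target: category \<D>
  for \<C> :: "('o, 'm) category" and \<D> :: "('p, 'n) category" +
  fixes F :: "('o, 'm, 'p, 'n) functor_data"
  assumes OMap_closed: "X \<in> Obj \<C> \<Longrightarrow> OMap F X \<in> Obj \<D>"
    and AMap_closed: "f \<in> Hom \<C> X Y \<Longrightarrow> AMap F f \<in> Hom \<D> (OMap F X) (OMap F Y)"
    and AMap_Id: "X \<in> Obj \<C> \<Longrightarrow> AMap F (Id \<C> X) = Id \<D> (OMap F X)"
    and AMap_Comp: "f \<in> Hom \<C> X Y \<Longrightarrow> g \<in> Hom \<C> Y Z \<Longrightarrow>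
      AMap F (g \<cdot>\<^bsub>\<C>\<^esub> f) = AMap F g \<cdot>\<^bsub>\<D>\<^esub> AMap F f"

definition functor_comp ::
    "('p, 'n, 'q, 'r) functor_data \<Rightarrow> ('o, 'm, 'p, 'n) functor_data \<Rightarrow> ('o, 'm, 'q, 'r) functor_data"
    (infixr \<open>\<circ>\<^sub>F\<close> 75) where
  "G \<circ>\<^sub>F F = \<lparr>OMap = OMap G \<circ> OMap F, AMap = AMap G \<circ> AMap F\<rparr>"

text \<open>
  The maps of a functor are HOL functions, whose values off the source category are irrelevant;
  hence equality of functors is equality on the objects and arrows of the source.
\<close>

definition functor_eq ::
    "('o, 'm) category \<Rightarrow> ('o, 'm, 'p, 'n) functor_data \<Rightarrow> ('o, 'm, 'p, 'n) functor_data \<Rightarrow> bool" where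
  "functor_eq \<C> F G \<longleftrightarrow>
    (\<forall>X \<in> Obj \<C>. OMap F X = OMap G X) \<and> (\<forall>f \<in> Arr \<C>. AMap F f = AMap G f)"

locale nat_trans = dom: cat_functor \<C> \<D> F + cod: cat_functor \<C> \<D> G
  for \<C> :: "('o, 'm) category" and \<D> :: "('p, 'n) category" and F G +
  fixes \<eta> :: "'o \<Rightarrow> 'n"
  assumes component: "X \<in> Obj \<C> \<Longrightarrow> \<eta> X \<in> Hom \<D> (OMap F X) (OMap G X)"
    and naturality: "f \<in> Hom \<C> X Y \<Longrightarrow> AMap G f \<cdot>\<^bsub>\<D>\<^esub> \<eta> X = \<eta> Y \<cdot>\<^bsub>\<D>\<^esub> AMap F f"

definition cartesian ::
    "('o, 'm) category \<Rightarrow> ('p, 'n) category \<Rightarrow> ('o, 'm, 'p, 'n) functor_data \<Rightarrow> 'm \<Rightarrow> bool" where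
  "cartesian \<E> \<B> p f \<longleftrightarrow> f \<in> Arr \<E> \<and>
    (\<forall>R \<in> Obj \<E>. \<forall>g \<in> Hom \<E> R (Cod \<E> f). \<forall>h \<in> Hom \<B> (OMap p R) (OMap p (Dom \<E> f)).
      AMap p f \<cdot>\<^bsub>\<B>\<^esub> h = AMap p g \<longrightarrow>
      (\<exists>!k. k \<in> Hom \<E> R (Dom \<E> f) \<and> AMap p k = h \<and> f \<cdot>\<^bsub>\<E>\<^esub> k = g))"

locale fibration = cat_functor \<E> \<B> p
  for \<E> :: "('o, 'm) category" and \<B> :: "('p, 'n) category" and p +
  assumes cartesian_lift: "Q \<in> Obj \<E> \<Longrightarrow> u \<in> Hom \<B> X (OMap p Q) \<Longrightarrow>
    \<exists>P \<in> Obj \<E>. \<exists>f \<in> Hom \<E> P Q. AMap p f = u \<and> cartesian \<E> \<B> p f"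

text \<open>
  The fiber over \<open>X\<close> as an order: \<open>P \<sqsubseteq> Q\<close> iff there is an arrow from \<open>P\<close> to \<open>Q\<close> over the
  identity of \<open>X\<close>. Thinness of the fiber category is required separately in
  \<open>posetal_fibration\<close>.
\<close>

definition fiber ::
    "('o, 'm) category \<Rightarrow> ('p, 'n) category \<Rightarrow> ('o, 'm, 'p, 'n) functor_data \<Rightarrow> 'p \<Rightarrow> 'o gorder" where
  "fiber \<E> \<B> p X = \<lparr>carrier = {P \<in> Obj \<E>. OMap p P = X}, eq = (=),
    le = (\<lambda>P Q. \<exists>f \<in> Hom \<E> P Q. AMap p f = Id \<B> X)\<rparr>"

locale posetal_fibration = fibration +
  assumes fiber_thin: "X \<in> Obj \<B> \<Longrightarrow> f \<in> Hom \<E> P Q \<Longrightarrow> g \<in> Hom \<E> P Q \<Longrightarrow>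
      AMap p f = Id \<B> X \<Longrightarrow> AMap p g = Id \<B> X \<Longrightarrow> f = g"
    and fiber_partial_order: "X \<in> Obj \<B> \<Longrightarrow> partial_order (fiber \<E> \<B> p X)"

text \<open>
  The reindexing \<open>u\<^sup>* Q\<close>. In a posetal fibration the domain of a cartesian lift of \<open>u\<close> to \<open>Q\<close> is
  unique, because two such domains are isomorphic in their fiber.
\<close>

definition reindex ::
    "('o, 'm) category \<Rightarrow> ('p, 'n) category \<Rightarrow> ('o, 'm, 'p, 'n) functor_data \<Rightarrow> 'n \<Rightarrow> 'o \<Rightarrow> 'o" where
  "reindex \<E> \<B> p u Q = (THE P. \<exists>f \<in> Hom \<E> P Q. AMap p f = u \<and> cartesian \<E> \<B> p f)"

locale clat_fibration = posetal_fibration +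
  assumes fiber_complete_lattice: "X \<in> Obj \<B> \<Longrightarrow> complete_lattice (fiber \<E> \<B> p X)"
    and reindex_preserves_meets: "u \<in> Hom \<B> X Y \<Longrightarrow>
      inf_pres (fiber \<E> \<B> p Y) (fiber \<E> \<B> p X) (reindex \<E> \<B> p u)"

locale clat_fibration_truth_values =
  clat_fibration \<E> \<B> p + index: discrete_category \<A> +
  base: cat_functor \<A> \<B> \<O> + truth: cat_functor \<A> \<E> \<Omega>
  for \<E> :: "('e, 'em) category" and \<B> :: "('b, 'bm) category" and p
    and \<A> :: "('a, 'am) category" and \<O> and \<Omega> +
  assumes base_eq: "functor_eq \<A> \<O> (p \<circ>\<^sub>F \<Omega>)"

text \<open>
  The meet is taken in the fiber of \<open>q\<close> over \<open>F (p P)\<close>; when no pair \<open>(a, k)\<close> exists it is the top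
  element of that fiber.
\<close>

definition codensity_lifting ::
    "('e, 'em) category \<Rightarrow> ('b, 'bm, 'c, 'cm) functor_data \<Rightarrow> ('e, 'em, 'b, 'bm) functor_data \<Rightarrow>
     ('f, 'fm) category \<Rightarrow> ('c, 'cm) category \<Rightarrow> ('f, 'fm, 'c, 'cm) functor_data \<Rightarrow>
     ('a, 'am) category \<Rightarrow> ('a, 'am, 'e, 'em) functor_data \<Rightarrow> ('a, 'am, 'f, 'fm) functor_data \<Rightarrow>
     ('a \<Rightarrow> 'cm) \<Rightarrow> 'e \<Rightarrow> 'f" where
  "codensity_lifting \<E> F p \<F> \<C> q \<A> \<Omega> \<Omega>' \<tau> P =
    \<Sqinter>\<^bsub>fiber \<F> \<C> q (OMap F (OMap p P))\<^esub>
      {reindex \<F> \<C> q (\<tau> a \<cdot>\<^bsub>\<C>\<^esub> AMap F (AMap p k)) (OMap \<Omega>' a) | a k.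
        a \<in> Obj \<A> \<and> k \<in> Hom \<E> P (OMap \<Omega> a)}"

definition functor_lifting ::
    "('e, 'em) category \<Rightarrow> ('b, 'bm) category \<Rightarrow> ('e, 'em, 'b, 'bm) functor_data \<Rightarrow>
     ('f, 'fm) category \<Rightarrow> ('c, 'cm) category \<Rightarrow> ('f, 'fm, 'c, 'cm) functor_data \<Rightarrow>
     ('b, 'bm, 'c, 'cm) functor_data \<Rightarrow> ('e, 'em, 'f, 'fm) functor_data \<Rightarrow> bool" where
  "functor_lifting \<E> \<B> p \<F> \<C> q F Fdot \<longleftrightarrow>
    cat_functor \<B> \<C> F \<and> cat_functor \<E> \<F> Fdot \<and> functor_eq \<E> (q \<circ>\<^sub>F Fdot) (F \<circ>\<^sub>F p)"

end

theory Submission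
  imports Defs
begin

text \<open>
  Both directions rest on the universal property of reindexing, \<open>P \<sqsubseteq> u\<^sup>* Q\<close> iff \<open>u\<close> underlies an
  arrow from \<open>P\<close> to \<open>Q\<close>. If \<open>\<tau>\<close> lifts to arrows \<open>g\<^sub>a\<close>, then the composite of \<open>g\<^sub>a\<close> with the image of
  \<open>k\<close> under the lifted functor lies over \<open>\<tau> a \<cdot> F (p k)\<close>, which bounds every component of the meet.
  Conversely, the component of the meet at \<open>k = Id\<close> is \<open>(\<tau> a)\<^sup>* (\<Omega>' a)\<close>.
\<close>

lemma HomD:
  assumes "f \<in> Hom \<C> X Y"
  shows "f \<in> Arr \<C>" "Dom \<C> f = X" "Cod \<C> f = Y"
  using assms by (auto simp: Hom_def)

lemma (in category) Hom_Obj: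
  assumes "f \<in> Hom \<C> X Y"
  shows "X \<in> Obj \<C>" "Y \<in> Obj \<C>"
  using assms Dom_closed Cod_closed by (auto simp: Hom_def)

lemma cat_functor_comp:
  assumes "cat_functor \<C> \<D> F" and "cat_functor \<D> \<E> G"
  shows "cat_functor \<C> \<E> (G \<circ>\<^sub>F F)"
proof -
  interpret F: cat_functor \<C> \<D> F by fact
  interpret G: cat_functor \<D> \<E> G by fact
  show ?thesis
    by unfold_locales
      (auto simp: functor_comp_def F.AMap_Id F.OMap_closed G.AMap_Id G.OMap_closed
        intro: F.AMap_closed G.AMap_closed
        simp: F.AMap_Comp G.AMap_Comp[OF F.AMap_closed F.AMap_closed])
qed

text \<open>Every arrow of a discrete category is an identity, so each naturality square collapses
  to the two unit laws. A bare choice of components is therefore enough, which is how the last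
  equivalence of the theorem obtains its transformation.\<close>

lemma nat_trans_discreteI:
  assumes "discrete_category \<A>" and "cat_functor \<A> \<D> F" and "cat_functor \<A> \<D> G"
    and comp: "\<And>X. X \<in> Obj \<A> \<Longrightarrow> \<eta> X \<in> Hom \<D> (OMap F X) (OMap G X)"
  shows "nat_trans \<A> \<D> F G \<eta>"
proof -
  interpret discrete_category \<A> by fact
  interpret F: cat_functor \<A> \<D> F by fact
  interpret G: cat_functor \<A> \<D> G by fact
  show ?thesis
  proof
    fix f X Y assume f: "f \<in> Hom \<A> X Y"
    have X: "X \<in> Obj \<A>" using Hom_Obj f by blast
    have f_Id: "f = Id \<A> X" using arrows_are_identities f by (auto simp: Hom_def)
    have "Y = X" using f Id_closed[OF X] f_Id by (auto simp: Hom_def)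
    then show "AMap G f \<cdot>\<^bsub>\<D>\<^esub> \<eta> X = \<eta> Y \<cdot>\<^bsub>\<D>\<^esub> AMap F f"
      using comp[OF X] f_Id
      by (simp add: F.AMap_Id[OF X] G.AMap_Id[OF X] F.target.Comp_Id_left F.target.Comp_Id_right)
  qed (fact comp)
qed

context posetal_fibration
begin

lemma cartesian_factor:
  assumes "cartesian \<E> \<B> p f" and f: "f \<in> Hom \<E> R Q" and g: "g \<in> Hom \<E> P Q"
    and h: "h \<in> Hom \<B> (OMap p P) (OMap p R)" and "AMap p f \<cdot>\<^bsub>\<B>\<^esub> h = AMap p g"
  shows "\<exists>k \<in> Hom \<E> P R. AMap p k = h"
proof -
  have "P \<in> Obj \<E>" using source.Hom_Obj g by blast
  then show ?thesis
    using assms HomD[OF f] unfolding cartesian_def by metis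
qed

text \<open>Since \<open>f\<close> and \<open>g\<close> lie over the same base arrow,
  \<open>AMap p g\<close> factors through \<open>AMap p f\<close> by an identity. The factorization
  of \<open>g\<close> through the cartesian \<open>f\<close> is then vertical, that is, an
  inequality in the fiber.\<close>

lemma cartesian_fiber_greatest:
  assumes cart: "cartesian \<E> \<B> p f" and f: "f \<in> Hom \<E> R Q" and g: "g \<in> Hom \<E> P Q"
    and eq: "AMap p f = AMap p g" and X: "OMap p P = X"
  shows "P \<sqsubseteq>\<^bsub>fiber \<E> \<B> p X\<^esub> R"
proof -
  have pf: "AMap p f \<in> Hom \<B> (OMap p R) (OMap p Q)" by (rule AMap_closed[OF f])
  have pg: "AMap p g \<in> Hom \<B> (OMap p P) (OMap p Q)" by (rule AMap_closed[OF g])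
  \<comment> \<open>The two images are one and the same base arrow, so their domains
    coincide.\<close>
  have "OMap p R = X" using pf pg eq X by (auto simp: Hom_def)
  moreover have "X \<in> Obj \<B>" using target.Hom_Obj pg X by blast
  ultimately have "\<exists>k \<in> Hom \<E> P R. AMap p k = Id \<B> X"
    using pg eq X target.Id_closed target.Comp_Id_right
    by (intro cartesian_factor[OF cart f g]) auto
  then show ?thesis by (simp add: fiber_def)
qed

text \<open>This justifies the definite description in \<open>reindex\<close>. A lift exists by the
  fibration axiom; the domains of two cartesian lifts of \<open>u\<close> are below each other in
  the fiber, hence equal by antisymmetry.\<close>

lemma reindex_cartesian:
  assumes Q: "Q \<in> Obj \<E>" and u: "u \<in> Hom \<B> X (OMap p Q)"
  shows "\<exists>f \<in> Hom \<E> (reindex \<E> \<B> p u Q) Q. AMap p f = u \<and> cartesian \<E> \<B> p f"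
proof -
  define lift where "lift P \<longleftrightarrow> (\<exists>f \<in> Hom \<E> P Q. AMap p f = u \<and> cartesian \<E> \<B> p f)" for P
  have X: "X \<in> Obj \<B>" using target.Hom_Obj u by blast
  have fib: "P \<in> carrier (fiber \<E> \<B> p X)" if P: "lift P" for P
  proof -
    obtain f where f: "f \<in> Hom \<E> P Q" "AMap p f = u" using P lift_def by blast
    then show ?thesis
      using AMap_closed[OF f(1)] u source.Hom_Obj(1)[OF f(1)] by (simp add: fiber_def Hom_def)
  qed
  \<comment> \<open>Here the lift from \<open>P'\<close> acts as the cartesian arrow and the lift
    from \<open>P\<close> merely as an arrow over \<open>u\<close>; exchanging the roles gives the
    reverse inequality.\<close>
  have le: "P \<sqsubseteq>\<^bsub>fiber \<E> \<B> p X\<^esub> P'" if "lift P" "lift P'" for P P'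
    using that fib[OF that(1)] cartesian_fiber_greatest unfolding lift_def
    by (fastforce simp: fiber_def)
  interpret fib: partial_order "fiber \<E> \<B> p X" by (rule fiber_partial_order[OF X])
  have "\<exists>!P. lift P"
  proof (rule ex_ex1I)
    show "\<exists>P. lift P" using cartesian_lift[OF Q u] lift_def by blast
    show "P = P'" if "lift P" "lift P'" for P P'
      using fib.le_antisym[OF le[OF that] le[OF that(2,1)] fib fib] that
      by (simp add: fiber_def)
  qed
  then have "lift (THE P. lift P)" by (rule theI')
  then show ?thesis unfolding lift_def reindex_def .
qed

lemma reindex_in_fiber:
  assumes Q: "Q \<in> Obj \<E>" and u: "u \<in> Hom \<B> X (OMap p Q)"
  shows "reindex \<E> \<B> p u Q \<in> carrier (fiber \<E> \<B> p X)"
proof -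
  obtain f where f: "f \<in> Hom \<E> (reindex \<E> \<B> p u Q) Q" "AMap p f = u"
    using reindex_cartesian[OF Q u] by blast
  then show ?thesis
    using AMap_closed[OF f(1)] u source.Hom_Obj(1)[OF f(1)] by (simp add: fiber_def Hom_def)
qed

text \<open>Composing a vertical arrow with the cartesian lift \<open>f\<close> of \<open>u\<close>
  gives an arrow over \<open>u\<close>; conversely, an arrow over \<open>u\<close> factors
  vertically through \<open>f\<close>.\<close>

lemma le_reindex_iff:
  assumes Q: "Q \<in> Obj \<E>" and u: "u \<in> Hom \<B> X (OMap p Q)" and P: "OMap p P = X"
  shows "P \<sqsubseteq>\<^bsub>fiber \<E> \<B> p X\<^esub> reindex \<E> \<B> p u Q \<longleftrightarrow> (\<exists>g \<in> Hom \<E> P Q. AMap p g = u)"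
proof -
  obtain f where f: "f \<in> Hom \<E> (reindex \<E> \<B> p u Q) Q" "AMap p f = u" "cartesian \<E> \<B> p f"
    using reindex_cartesian[OF Q u] by blast
  show ?thesis
  proof
    assume "P \<sqsubseteq>\<^bsub>fiber \<E> \<B> p X\<^esub> reindex \<E> \<B> p u Q"
    then obtain k where k: "k \<in> Hom \<E> P (reindex \<E> \<B> p u Q)" "AMap p k = Id \<B> X"
      by (auto simp: fiber_def)
    have "AMap p (f \<cdot>\<^bsub>\<E>\<^esub> k) = u"
      using AMap_Comp[OF k(1) f(1)] k(2) f(2) target.Comp_Id_right[OF u] by simp
    then show "\<exists>g \<in> Hom \<E> P Q. AMap p g = u"
      using source.Comp_closed[OF k(1) f(1)] by blast
  next
    assume "\<exists>g \<in> Hom \<E> P Q. AMap p g = u"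
    then show "P \<sqsubseteq>\<^bsub>fiber \<E> \<B> p X\<^esub> reindex \<E> \<B> p u Q"
      using cartesian_fiber_greatest[OF f(3,1)] f(2) P by metis
  qed
qed

end

theorem theorem3:
  fixes \<E> :: "('e, 'em) category" and \<B> :: "('b, 'bm) category"
    and \<F> :: "('f, 'fm) category" and \<C> :: "('c, 'cm) category"
    and \<A> :: "('a, 'am) category"
    and p :: "('e, 'em, 'b, 'bm) functor_data" and q :: "('f, 'fm, 'c, 'cm) functor_data"
    and \<O> :: "('a, 'am, 'b, 'bm) functor_data" and \<Omega> :: "('a, 'am, 'e, 'em) functor_data"
    and \<O>' :: "('a, 'am, 'c, 'cm) functor_data" and \<Omega>' :: "('a, 'am, 'f, 'fm) functor_data"
    and F :: "('b, 'bm, 'c, 'cm) functor_data" and Fdot :: "('e, 'em, 'f, 'fm) functor_data"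
    and \<tau> :: "'a \<Rightarrow> 'cm"
  assumes "clat_fibration_truth_values \<E> \<B> p \<A> \<O> \<Omega>"
    and "clat_fibration_truth_values \<F> \<C> q \<A> \<O>' \<Omega>'"
    and "cat_functor \<B> \<C> F"
    and "nat_trans \<A> \<C> (F \<circ>\<^sub>F \<O>) \<O>' \<tau>"
    and "functor_lifting \<E> \<B> p \<F> \<C> q F Fdot"
  shows "((\<forall>P \<in> Obj \<E>. OMap Fdot P
              \<sqsubseteq>\<^bsub>fiber \<F> \<C> q (OMap F (OMap p P))\<^esub> codensity_lifting \<E> F p \<F> \<C> q \<A> \<Omega> \<Omega>' \<tau> P)
            \<longleftrightarrow>
          (\<forall>a \<in> Obj \<A>. \<exists>g \<in> Hom \<F> (OMap Fdot (OMap \<Omega> a)) (OMap \<Omega>' a). AMap q g = \<tau> a))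
       \<and> (\<forall>a \<in> Obj \<A>.
            (\<exists>g \<in> Hom \<F> (OMap Fdot (OMap \<Omega> a)) (OMap \<Omega>' a). AMap q g = \<tau> a)
            \<longleftrightarrow>
            OMap Fdot (OMap \<Omega> a)
              \<sqsubseteq>\<^bsub>fiber \<F> \<C> q (OMap F (OMap \<O> a))\<^esub> reindex \<F> \<C> q (\<tau> a) (OMap \<Omega>' a))
       \<and> ((\<forall>a \<in> Obj \<A>. \<exists>g \<in> Hom \<F> (OMap Fdot (OMap \<Omega> a)) (OMap \<Omega>' a). AMap q g = \<tau> a)
            \<longleftrightarrow>
          (\<exists>\<sigma>. nat_trans \<A> \<F> (Fdot \<circ>\<^sub>F \<Omega>) \<Omega>' \<sigma> \<and> (\<forall>a \<in> Obj \<A>. AMap q (\<sigma> a) = \<tau> a)))"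
proof -
  interpret E: clat_fibration_truth_values \<E> \<B> p \<A> \<O> \<Omega> by fact
  interpret Q: clat_fibration_truth_values \<F> \<C> q \<A> \<O>' \<Omega>' by fact
  interpret F: cat_functor \<B> \<C> F by fact
  interpret T: nat_trans \<A> \<C> "F \<circ>\<^sub>F \<O>" \<O>' \<tau> by fact
  interpret D: cat_functor \<E> \<F> Fdot using assms(5) by (simp add: functor_lifting_def)
  have q_Fdot: "OMap q (OMap Fdot P) = OMap F (OMap p P)" if "P \<in> Obj \<E>" for P
    using assms(5) that by (simp add: functor_lifting_def functor_eq_def functor_comp_def)
  have q_Fdot_arr: "AMap q (AMap Fdot k) = AMap F (AMap p k)" if "k \<in> Hom \<E> P P'" for k P P'
    using assms(5) HomD(1)[OF that]
    by (simp add: functor_lifting_def functor_eq_def functor_comp_def)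
  have O_eq: "OMap \<O> a = OMap p (OMap \<Omega> a)" "OMap \<O>' a = OMap q (OMap \<Omega>' a)"
    if "a \<in> Obj \<A>" for a
    using E.base_eq Q.base_eq that by (auto simp: functor_eq_def functor_comp_def)
  \<comment> \<open>The identities \<open>O_eq\<close> move the endpoints of \<open>\<tau> a\<close>
    to the images of \<open>\<Omega> a\<close> and \<open>\<Omega>' a\<close>. In this form it
    composes with \<open>F (p k)\<close> and can reindex \<open>\<Omega>' a\<close>.\<close>
  have \<tau>: "\<tau> a \<in> Hom \<C> (OMap F (OMap p (OMap \<Omega> a))) (OMap q (OMap \<Omega>' a))" if "a \<in> Obj \<A>" for a
    using T.component[OF that] O_eq[OF that] by (simp add: functor_comp_def)
  have \<tau>k: "\<tau> a \<cdot>\<^bsub>\<C>\<^esub> AMap F (AMap p k) \<in> Hom \<C> (OMap F (OMap p P)) (OMap q (OMap \<Omega>' a))"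
    if "a \<in> Obj \<A>" "k \<in> Hom \<E> P (OMap \<Omega> a)" for a k P
    by (rule Q.target.Comp_closed[OF F.AMap_closed[OF E.AMap_closed[OF that(2)]] \<tau>[OF that(1)]])
  let ?lifts = "\<lambda>a. \<exists>g \<in> Hom \<F> (OMap Fdot (OMap \<Omega> a)) (OMap \<Omega>' a). AMap q g = \<tau> a"
  have lifts_iff: "?lifts a \<longleftrightarrow> OMap Fdot (OMap \<Omega> a)
      \<sqsubseteq>\<^bsub>fiber \<F> \<C> q (OMap F (OMap p (OMap \<Omega> a)))\<^esub> reindex \<F> \<C> q (\<tau> a) (OMap \<Omega>' a)"
    if "a \<in> Obj \<A>" for a
    using Q.le_reindex_iff[OF Q.truth.OMap_closed[OF that] \<tau>[OF that]
        q_Fdot[OF E.truth.OMap_closed[OF that]]] by simp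
  let ?S = "\<lambda>P. {reindex \<F> \<C> q (\<tau> a \<cdot>\<^bsub>\<C>\<^esub> AMap F (AMap p k)) (OMap \<Omega>' a) | a k.
        a \<in> Obj \<A> \<and> k \<in> Hom \<E> P (OMap \<Omega> a)}"
  \<comment> \<open>The order-theoretic laws of the meet hold only for subsets of the carrier, so
    each reindexed object must first be placed in the fiber.\<close>
  have S_fiber: "?S P \<subseteq> carrier (fiber \<F> \<C> q (OMap F (OMap p P)))" for P
    using Q.reindex_in_fiber[OF Q.truth.OMap_closed \<tau>k] by auto
  have Fdot_fiber: "OMap Fdot P \<in> carrier (fiber \<F> \<C> q (OMap F (OMap p P)))"
    if "P \<in> Obj \<E>" for P
    using that by (simp add: fiber_def q_Fdot D.OMap_closed)
  have lattice: "complete_lattice (fiber \<F> \<C> q (OMap F (OMap p P)))" if "P \<in> Obj \<E>" for P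
    by (rule Q.fiber_complete_lattice[OF F.OMap_closed[OF E.OMap_closed[OF that]]])
  have "(\<forall>P \<in> Obj \<E>. OMap Fdot P
      \<sqsubseteq>\<^bsub>fiber \<F> \<C> q (OMap F (OMap p P))\<^esub> codensity_lifting \<E> F p \<F> \<C> q \<A> \<Omega> \<Omega>' \<tau> P)
    \<longleftrightarrow> (\<forall>a \<in> Obj \<A>. ?lifts a)" (is "?below \<longleftrightarrow> ?all_lift")
  proof (intro iffI ballI)
    fix a assume below: ?below and a: "a \<in> Obj \<A>"
    let ?P = "OMap \<Omega> a"
    have P: "?P \<in> Obj \<E>" by (rule E.truth.OMap_closed[OF a])
    interpret L: complete_lattice "fiber \<F> \<C> q (OMap F (OMap p ?P))" by (rule lattice[OF P])
    \<comment> \<open>Both \<open>p\<close> and \<open>F\<close> preserve the identity of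
      \<open>\<Omega> a\<close>, so the index \<open>(a, Id)\<close> contributes exactly the
      reindexing along \<open>\<tau> a\<close>.\<close>
    have "\<tau> a \<cdot>\<^bsub>\<C>\<^esub> AMap F (AMap p (Id \<E> ?P)) = \<tau> a"
      using Q.target.Comp_Id_right[OF \<tau>[OF a]]
      by (simp add: E.AMap_Id[OF P] F.AMap_Id[OF E.OMap_closed[OF P]])
    then have mem: "reindex \<F> \<C> q (\<tau> a) (OMap \<Omega>' a) \<in> ?S ?P"
      using a E.source.Id_closed[OF P] by (intro CollectI exI[of _ a] exI[of _ "Id \<E> ?P"]) simp
    have "OMap Fdot ?P \<sqsubseteq>\<^bsub>fiber \<F> \<C> q (OMap F (OMap p ?P))\<^esub> reindex \<F> \<C> q (\<tau> a) (OMap \<Omega>' a)"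
    proof (rule L.le_trans)
      show "OMap Fdot ?P \<sqsubseteq>\<^bsub>fiber \<F> \<C> q (OMap F (OMap p ?P))\<^esub>
          \<Sqinter>\<^bsub>fiber \<F> \<C> q (OMap F (OMap p ?P))\<^esub> ?S ?P"
        using below P unfolding codensity_lifting_def by blast
      show "\<Sqinter>\<^bsub>fiber \<F> \<C> q (OMap F (OMap p ?P))\<^esub> ?S ?P
          \<sqsubseteq>\<^bsub>fiber \<F> \<C> q (OMap F (OMap p ?P))\<^esub> reindex \<F> \<C> q (\<tau> a) (OMap \<Omega>' a)"
        by (rule L.inf_lower[OF S_fiber mem])
    \<comment> \<open>What remains are the carrier conditions of transitivity for the three objects
      involved.\<close>
    qed (use mem S_fiber Fdot_fiber[OF P] L.inf_closed[OF S_fiber] in blast)+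
    then show "?lifts a" using lifts_iff[OF a] by simp
  next
    fix P assume all_lift: ?all_lift and P: "P \<in> Obj \<E>"
    interpret L: complete_lattice "fiber \<F> \<C> q (OMap F (OMap p P))" by (rule lattice[OF P])
    show "OMap Fdot P
      \<sqsubseteq>\<^bsub>fiber \<F> \<C> q (OMap F (OMap p P))\<^esub> codensity_lifting \<E> F p \<F> \<C> q \<A> \<Omega> \<Omega>' \<tau> P"
      unfolding codensity_lifting_def
    \<comment> \<open>It suffices to bound \<open>Fdot P\<close> by each member of the family; if
      the family is empty, nothing remains to be shown and the meet is the top element.\<close>
    proof (rule L.inf_greatest[OF S_fiber Fdot_fiber[OF P]])
      fix R assume "R \<in> ?S P"
      then obtain a k where a: "a \<in> Obj \<A>" and k: "k \<in> Hom \<E> P (OMap \<Omega> a)"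
        and R: "R = reindex \<F> \<C> q (\<tau> a \<cdot>\<^bsub>\<C>\<^esub> AMap F (AMap p k)) (OMap \<Omega>' a)" by blast
      obtain g where g: "g \<in> Hom \<F> (OMap Fdot (OMap \<Omega> a)) (OMap \<Omega>' a)" "AMap q g = \<tau> a"
        using all_lift a by blast
      note Fk = D.AMap_closed[OF k]
      have "AMap q (g \<cdot>\<^bsub>\<F>\<^esub> AMap Fdot k) = \<tau> a \<cdot>\<^bsub>\<C>\<^esub> AMap F (AMap p k)"
        using Q.AMap_Comp[OF Fk g(1)] g(2) q_Fdot_arr[OF k] by simp
      then show "OMap Fdot P \<sqsubseteq>\<^bsub>fiber \<F> \<C> q (OMap F (OMap p P))\<^esub> R"
        using Q.source.Comp_closed[OF Fk g(1)]
          Q.le_reindex_iff[OF Q.truth.OMap_closed[OF a] \<tau>k[OF a k] q_Fdot[OF P]] R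
        by blast
    qed
  qed
  \<comment> \<open>Only the name of the base object changes here: \<open>\<O> a\<close> equals
    \<open>p (\<Omega> a)\<close>.\<close>
  moreover have "\<forall>a \<in> Obj \<A>. ?lifts a \<longleftrightarrow> OMap Fdot (OMap \<Omega> a)
      \<sqsubseteq>\<^bsub>fiber \<F> \<C> q (OMap F (OMap \<O> a))\<^esub> reindex \<F> \<C> q (\<tau> a) (OMap \<Omega>' a)"
    using lifts_iff O_eq(1) by simp
  moreover have "(\<forall>a \<in> Obj \<A>. ?lifts a) \<longleftrightarrow>
    (\<exists>\<sigma>. nat_trans \<A> \<F> (Fdot \<circ>\<^sub>F \<Omega>) \<Omega>' \<sigma> \<and> (\<forall>a \<in> Obj \<A>. AMap q (\<sigma> a) = \<tau> a))"
  proof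
    assume "\<forall>a \<in> Obj \<A>. ?lifts a"
    \<comment> \<open>The axiom of choice selects one arrow over each \<open>\<tau> a\<close>;
      discreteness of \<open>\<A>\<close> makes any such selection natural.\<close>
    then obtain \<sigma> where \<sigma>: "\<And>a. a \<in> Obj \<A> \<Longrightarrow>
        \<sigma> a \<in> Hom \<F> (OMap Fdot (OMap \<Omega> a)) (OMap \<Omega>' a) \<and> AMap q (\<sigma> a) = \<tau> a"
      by metis
    have "nat_trans \<A> \<F> (Fdot \<circ>\<^sub>F \<Omega>) \<Omega>' \<sigma>"
      by (rule nat_trans_discreteI[OF E.index.discrete_category_axioms
            cat_functor_comp[OF E.truth.cat_functor_axioms D.cat_functor_axioms]
            Q.truth.cat_functor_axioms])
        (use \<sigma> in \<open>simp add: functor_comp_def\<close>)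
    then show "\<exists>\<sigma>. nat_trans \<A> \<F> (Fdot \<circ>\<^sub>F \<Omega>) \<Omega>' \<sigma> \<and> (\<forall>a \<in> Obj \<A>. AMap q (\<sigma> a) = \<tau> a)"
      using \<sigma> by blast
  next
    assume "\<exists>\<sigma>. nat_trans \<A> \<F> (Fdot \<circ>\<^sub>F \<Omega>) \<Omega>' \<sigma> \<and> (\<forall>a \<in> Obj \<A>. AMap q (\<sigma> a) = \<tau> a)"
    then show "\<forall>a \<in> Obj \<A>. ?lifts a"
      using nat_trans.component[of \<A> \<F> "Fdot \<circ>\<^sub>F \<Omega>" \<Omega>'] unfolding functor_comp_def
      by (metis comp_apply functor_data.select_convs(1))
  qed
  ultimately show ?thesis by blast
qed

end
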